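(* Let $\mathcal{C}$ and $\mathcal{D}$ be abelian categories with enough projective objects, let $F:\mathcal{C}\rightarrow\mathcal{D}$ and $G:\mathcal{D}\rightarrow\mathcal{C}$ be covariant functors, and let $(F,G)$ be a Frobenius pair. (1) Assume that $G$ is separable. If $\mathcal{GP}(\mathcal{C})$ is precovering in $\mathcal{C}$, then $\mathcal{GP}(\mathcal{D})$ is precovering in $\mathcal{D}$. (2) Assume that $F$ is separable. If $\mathcal{GP}(\mathcal{D})$ is precovering in $\mathcal{D}$, then $\mathcal{GP}(\mathcal{C})$ is precovering in $\mathcal{C}$.
   Context: Frobenius pair: $(F,G)$ is a Frobenius pair (and $F$, $G$ are called Frobenius functors) if both $(F,G)$ and $(G,F)$ are adjoint pairs, i.e. $G$ is both a right and a left adjoint of $F$. Separable functor: a covariant functor $F:\mathcal{C}\to\mathcal{D}$ is separable if for all objects $M,N$ in $\mathcal{C}$ there are maps $\varphi:\mathrm{Hom}_{\mathcal{D}}(F(M),F(N))\to\mathrm{Hom}_{\mathcal{C}}(M,N)$ such that (i) $\varphi(F(\theta))=\theta$ for every $\theta\in\mathrm{Hom}_{\mathcal{C}}(M,N)$; (ii) for all $M',N'$ in $\mathcal{C}$, $\alpha\in\mathrm{Hom}_{\mathcal{C}}(M,M')$, $\beta\in\mathrm{Hom}_{\mathcal{C}}(N,N')$, $f\in\mathrm{Hom}_{\mathcal{D}}(F(M),F(N))$, $g\in\mathrm{Hom}_{\mathcal{D}}(F(M'),F(N'))$, if $F(\beta)f=gF(\alpha)$ then $\beta\varphi(f)=\varphi(g)\alpha$.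 Gorenstein projective: for an abelian category $\mathcal{A}$ with enough projective objects, an object $M$ is Gorenstein projective if there is an exact complex of projective objects $\mathbf{P}:\cdots\to P_1\to P_0\to P^0\to P^1\to\cdots$ in $\mathcal{A}$ with $M\cong\ker(P^0\to P^1)$ such that $\mathrm{Hom}_{\mathcal{A}}(\mathbf{P},Q)$ is exact for every projective object $Q$. $\mathcal{GP}(\mathcal{A})$ denotes the subcategory (class) of Gorenstein projective objects of $\mathcal{A}$. Precovering: for a class $\mathcal{X}$ of objects of $\mathcal{A}$, a morphism $\varphi:X\to M$ with $X\in\mathcal{X}$ is an $\mathcal{X}$-precover of $M$ if for every morphism $f:X'\to M$ with $X'\in\mathcal{X}$ there is $g:X'\to X$ with $\varphi g=f$. $\mathcal{X}$ is precovering in $\mathcal{A}$ if every object of $\mathcal{A}$ has an $\mathcal{X}$-precover. *)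

theory Defs
  imports "HOL-Algebra.Group"
begin

section \<open>Categories and functors\<close>

record ('o, 'm) cat =
  Obj  :: "'o set"
  Arr  :: "'m set"
  Dom  :: "'m \<Rightarrow> 'o"
  Cod  :: "'m \<Rightarrow> 'o"
  Id   :: "'o \<Rightarrow> 'm"
  Comp :: "'m \<Rightarrow> 'm \<Rightarrow> 'm"  (infixr "\<cdot>\<index>" 70)

definition Hom :: "('o, 'm) cat \<Rightarrow> 'o \<Rightarrow> 'o \<Rightarrow> 'm set" where
  "Hom C A B = {f \<in> Arr C. Dom C f = A \<and> Cod C f = B}"

locale category =
  fixes C :: "('o, 'm) cat" (structure)
  assumes Dom_Obj: "f \<in> Arr C \<Longrightarrow> Dom C f \<in> Obj C"
    and Cod_Obj: "f \<in> Arr C \<Longrightarrow> Cod C f \<in> Obj C"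
    and Id_Hom: "A \<in> Obj C \<Longrightarrow> Id C A \<in> Hom C A A"
    and Comp_Hom: "f \<in> Hom C A B \<Longrightarrow> g \<in> Hom C B E \<Longrightarrow> g \<cdot> f \<in> Hom C A E"
    and Comp_Id: "f \<in> Hom C A B \<Longrightarrow> f \<cdot> Id C A = f"
    and Id_Comp: "f \<in> Hom C A B \<Longrightarrow> Id C B \<cdot> f = f"
    and Comp_assoc: "f \<in> Hom C A B \<Longrightarrow> g \<in> Hom C B E \<Longrightarrow> h \<in> Hom C E K \<Longrightarrow>
      (h \<cdot> g) \<cdot> f = h \<cdot> (g \<cdot> f)"

record ('o, 'm, 'p, 'n) functr =
  OMap :: "'o \<Rightarrow> 'p"
  AMap :: "'m \<Rightarrow> 'n"

locale covariant_functor = source: category C + target: category D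
  for C :: "('o, 'm) cat" and D :: "('p, 'n) cat" +
  fixes F :: "('o, 'm, 'p, 'n) functr"
  assumes OMap_Obj: "A \<in> Obj C \<Longrightarrow> OMap F A \<in> Obj D"
    and AMap_Hom: "f \<in> Hom C A B \<Longrightarrow> AMap F f \<in> Hom D (OMap F A) (OMap F B)"
    and AMap_Id: "A \<in> Obj C \<Longrightarrow> AMap F (Id C A) = Id D (OMap F A)"
    and AMap_Comp: "f \<in> Hom C A B \<Longrightarrow> g \<in> Hom C B E \<Longrightarrow>
      AMap F (g \<cdot>\<^bsub>C\<^esub> f) = AMap F g \<cdot>\<^bsub>D\<^esub> AMap F f"

text \<open>\<open>F\<close> is left adjoint to \<open>G\<close>: a bijection \<open>Hom\<^sub>D(F A, B) \<rightarrow> Hom\<^sub>C(A, G B)\<close>,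
  natural in \<open>A\<close> and in \<open>B\<close>.\<close>

definition adjoint_pair ::
  "('o, 'm) cat \<Rightarrow> ('p, 'n) cat \<Rightarrow> ('o, 'm, 'p, 'n) functr \<Rightarrow> ('p, 'n, 'o, 'm) functr \<Rightarrow> bool"
where
  "adjoint_pair C D F G \<longleftrightarrow>
     covariant_functor C D F \<and> covariant_functor D C G \<and>
     (\<exists>\<theta>. (\<forall>A \<in> Obj C. \<forall>B \<in> Obj D. bij_betw (\<theta> A B) (Hom D (OMap F A) B) (Hom C A (OMap G B))) \<and>
          (\<forall>A \<in> Obj C. \<forall>A' \<in> Obj C. \<forall>B \<in> Obj D. \<forall>a \<in> Hom C A' A. \<forall>f \<in> Hom D (OMap F A) B.
             \<theta> A' B (f \<cdot>\<^bsub>D\<^esub> AMap F a) = \<theta> A B f \<cdot>\<^bsub>C\<^esub> a) \<and>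
          (\<forall>A \<in> Obj C. \<forall>B \<in> Obj D. \<forall>B' \<in> Obj D. \<forall>b \<in> Hom D B B'. \<forall>f \<in> Hom D (OMap F A) B.
             \<theta> A B' (b \<cdot>\<^bsub>D\<^esub> f) = AMap G b \<cdot>\<^bsub>C\<^esub> \<theta> A B f))"

definition Frobenius_pair ::
  "('o, 'm) cat \<Rightarrow> ('p, 'n) cat \<Rightarrow> ('o, 'm, 'p, 'n) functr \<Rightarrow> ('p, 'n, 'o, 'm) functr \<Rightarrow> bool"
where
  "Frobenius_pair C D F G \<longleftrightarrow> adjoint_pair C D F G \<and> adjoint_pair D C G F"

definition separable_functor ::
  "('o, 'm) cat \<Rightarrow> ('p, 'n) cat \<Rightarrow> ('o, 'm, 'p, 'n) functr \<Rightarrow> bool"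
where
  "separable_functor C D F \<longleftrightarrow>
     covariant_functor C D F \<and>
     (\<exists>\<phi>. (\<forall>M \<in> Obj C. \<forall>N \<in> Obj C. \<forall>f \<in> Hom D (OMap F M) (OMap F N). \<phi> M N f \<in> Hom C M N) \<and>
          (\<forall>M \<in> Obj C. \<forall>N \<in> Obj C. \<forall>\<theta> \<in> Hom C M N. \<phi> M N (AMap F \<theta>) = \<theta>) \<and>
          (\<forall>M \<in> Obj C. \<forall>N \<in> Obj C. \<forall>M' \<in> Obj C. \<forall>N' \<in> Obj C.
             \<forall>\<alpha> \<in> Hom C M M'. \<forall>\<beta> \<in> Hom C N N'.
             \<forall>f \<in> Hom D (OMap F M) (OMap F N). \<forall>g \<in> Hom D (OMap F M') (OMap F N').
               AMap F \<beta> \<cdot>\<^bsub>D\<^esub> f = g \<cdot>\<^bsub>D\<^esub> AMap F \<alpha> \<longrightarrow>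
               \<beta> \<cdot>\<^bsub>C\<^esub> \<phi> M N f = \<phi> M' N' g \<cdot>\<^bsub>C\<^esub> \<alpha>))"


section \<open>Abelian categories\<close>

definition mono_arr :: "('o, 'm) cat \<Rightarrow> 'm \<Rightarrow> bool" where
  "mono_arr C f \<longleftrightarrow> f \<in> Arr C \<and>
     (\<forall>E \<in> Obj C. \<forall>g \<in> Hom C E (Dom C f). \<forall>h \<in> Hom C E (Dom C f).
        f \<cdot>\<^bsub>C\<^esub> g = f \<cdot>\<^bsub>C\<^esub> h \<longrightarrow> g = h)"

definition epi_arr :: "('o, 'm) cat \<Rightarrow> 'm \<Rightarrow> bool" where
  "epi_arr C f \<longleftrightarrow> f \<in> Arr C \<and>
     (\<forall>E \<in> Obj C. \<forall>g \<in> Hom C (Cod C f) E. \<forall>h \<in> Hom C (Cod C f) E.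
        g \<cdot>\<^bsub>C\<^esub> f = h \<cdot>\<^bsub>C\<^esub> f \<longrightarrow> g = h)"

definition isomorphic :: "('o, 'm) cat \<Rightarrow> 'o \<Rightarrow> 'o \<Rightarrow> bool" where
  "isomorphic C A B \<longleftrightarrow> A \<in> Obj C \<and> B \<in> Obj C \<and>
     (\<exists>f \<in> Hom C A B. \<exists>g \<in> Hom C B A. g \<cdot>\<^bsub>C\<^esub> f = Id C A \<and> f \<cdot>\<^bsub>C\<^esub> g = Id C B)"

definition zero_object :: "('o, 'm) cat \<Rightarrow> 'o \<Rightarrow> bool" where
  "zero_object C Z \<longleftrightarrow> Z \<in> Obj C \<and>
     (\<forall>A \<in> Obj C. (\<exists>!f. f \<in> Hom C A Z) \<and> (\<exists>!f. f \<in> Hom C Z A))"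

definition zero_arr :: "('o, 'm) cat \<Rightarrow> 'm \<Rightarrow> bool" where
  "zero_arr C f \<longleftrightarrow> f \<in> Arr C \<and>
     (\<exists>Z. zero_object C Z \<and> (\<exists>h \<in> Hom C (Dom C f) Z. \<exists>g \<in> Hom C Z (Cod C f). f = g \<cdot>\<^bsub>C\<^esub> h))"

definition binary_product :: "('o, 'm) cat \<Rightarrow> 'o \<Rightarrow> 'o \<Rightarrow> 'o \<Rightarrow> 'm \<Rightarrow> 'm \<Rightarrow> bool" where
  "binary_product C A B P p q \<longleftrightarrow> P \<in> Obj C \<and> p \<in> Hom C P A \<and> q \<in> Hom C P B \<and>
     (\<forall>E \<in> Obj C. \<forall>f \<in> Hom C E A. \<forall>g \<in> Hom C E B.
        \<exists>!u. u \<in> Hom C E P \<and> p \<cdot>\<^bsub>C\<^esub> u = f \<and> q \<cdot>\<^bsub>C\<^esub> u = g)"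

definition is_kernel :: "('o, 'm) cat \<Rightarrow> 'm \<Rightarrow> 'm \<Rightarrow> bool" where
  "is_kernel C k f \<longleftrightarrow> f \<in> Arr C \<and> k \<in> Arr C \<and> Cod C k = Dom C f \<and> zero_arr C (f \<cdot>\<^bsub>C\<^esub> k) \<and>
     (\<forall>h \<in> Arr C. Cod C h = Dom C f \<and> zero_arr C (f \<cdot>\<^bsub>C\<^esub> h) \<longrightarrow>
        (\<exists>!u. u \<in> Hom C (Dom C h) (Dom C k) \<and> k \<cdot>\<^bsub>C\<^esub> u = h))"

definition is_cokernel :: "('o, 'm) cat \<Rightarrow> 'm \<Rightarrow> 'm \<Rightarrow> bool" where
  "is_cokernel C c f \<longleftrightarrow> f \<in> Arr C \<and> c \<in> Arr C \<and> Dom C c = Cod C f \<and> zero_arr C (c \<cdot>\<^bsub>C\<^esub> f) \<and>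
     (\<forall>h \<in> Arr C. Dom C h = Cod C f \<and> zero_arr C (h \<cdot>\<^bsub>C\<^esub> f) \<longrightarrow>
        (\<exists>!u. u \<in> Hom C (Cod C c) (Cod C h) \<and> u \<cdot>\<^bsub>C\<^esub> c = h))"

text \<open>The (additive) group structures on the hom-sets are given by a family of HOL-Algebra groups
  \<open>H A B\<close>, whose operation is written multiplicatively there.\<close>

definition preadditive_structure :: "('o, 'm) cat \<Rightarrow> ('o \<Rightarrow> 'o \<Rightarrow> 'm monoid) \<Rightarrow> bool" where
  "preadditive_structure C H \<longleftrightarrow>
     (\<forall>A \<in> Obj C. \<forall>B \<in> Obj C. comm_group (H A B) \<and> carrier (H A B) = Hom C A B) \<and>
     (\<forall>A \<in> Obj C. \<forall>B \<in> Obj C. \<forall>E \<in> Obj C.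
        (\<forall>f \<in> Hom C A B. \<forall>g \<in> Hom C B E. \<forall>g' \<in> Hom C B E.
           (g \<otimes>\<^bsub>H B E\<^esub> g') \<cdot>\<^bsub>C\<^esub> f = (g \<cdot>\<^bsub>C\<^esub> f) \<otimes>\<^bsub>H A E\<^esub> (g' \<cdot>\<^bsub>C\<^esub> f)) \<and>
        (\<forall>f \<in> Hom C A B. \<forall>f' \<in> Hom C A B. \<forall>g \<in> Hom C B E.
           g \<cdot>\<^bsub>C\<^esub> (f \<otimes>\<^bsub>H A B\<^esub> f') = (g \<cdot>\<^bsub>C\<^esub> f) \<otimes>\<^bsub>H A E\<^esub> (g \<cdot>\<^bsub>C\<^esub> f')))"

text \<open>The preadditive structure is only required to exist: in the presence of a zero object and
  binary products it is determined by the category.\<close>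

locale abelian_category = category C for C :: "('o, 'm) cat" (structure) +
  assumes preadditive: "\<exists>H. preadditive_structure C H"
    and has_zero_object: "\<exists>Z. zero_object C Z"
    and has_binary_products:
      "A \<in> Obj C \<Longrightarrow> B \<in> Obj C \<Longrightarrow> \<exists>P p q. binary_product C A B P p q"
    and has_kernels: "f \<in> Arr C \<Longrightarrow> \<exists>k. is_kernel C k f"
    and has_cokernels: "f \<in> Arr C \<Longrightarrow> \<exists>c. is_cokernel C c f"
    and mono_normal: "mono_arr C f \<Longrightarrow> \<exists>g. is_kernel C f g"
    and epi_normal: "epi_arr C f \<Longrightarrow> \<exists>g. is_cokernel C f g"

definition projective_object :: "('o, 'm) cat \<Rightarrow> 'o \<Rightarrow> bool" where
  "projective_object C P \<longleftrightarrow> P \<in> Obj C \<and>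
     (\<forall>e f. epi_arr C e \<and> f \<in> Hom C P (Cod C e) \<longrightarrow>
        (\<exists>g \<in> Hom C P (Dom C e). e \<cdot>\<^bsub>C\<^esub> g = f))"

definition enough_projectives :: "('o, 'm) cat \<Rightarrow> bool" where
  "enough_projectives C \<longleftrightarrow>
     (\<forall>A \<in> Obj C. \<exists>P e. projective_object C P \<and> e \<in> Hom C P A \<and> epi_arr C e)"


section \<open>Complexes and Gorenstein projective objects\<close>

text \<open>Image in the sense of abelian categories: the kernel of a cokernel.\<close>

definition is_image :: "('o, 'm) cat \<Rightarrow> 'm \<Rightarrow> 'm \<Rightarrow> bool" where
  "is_image C m f \<longleftrightarrow> (\<exists>c. is_cokernel C c f \<and> is_kernel C m c)"

definition exact_at :: "('o, 'm) cat \<Rightarrow> 'm \<Rightarrow> 'm \<Rightarrow> bool" where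
  "exact_at C f g \<longleftrightarrow> (\<exists>m. is_image C m f \<and> is_kernel C m g)"

text \<open>Complexes are indexed by the integers with \<open>d n : X n \<rightarrow> X (n + 1)\<close>. The objects written
  \<open>\<dots> \<rightarrow> P\<^sub>1 \<rightarrow> P\<^sub>0 \<rightarrow> P\<^sup>0 \<rightarrow> P\<^sup>1 \<rightarrow> \<dots>\<close> are \<open>\<dots>, X (-2), X (-1), X 0, X 1, \<dots>\<close>.\<close>

definition complex_in :: "('o, 'm) cat \<Rightarrow> (int \<Rightarrow> 'o) \<Rightarrow> (int \<Rightarrow> 'm) \<Rightarrow> bool" where
  "complex_in C X d \<longleftrightarrow>
     (\<forall>n. X n \<in> Obj C \<and> d n \<in> Hom C (X n) (X (n + 1)) \<and> zero_arr C (d (n + 1) \<cdot>\<^bsub>C\<^esub> d n))"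

definition exact_complex :: "('o, 'm) cat \<Rightarrow> (int \<Rightarrow> 'o) \<Rightarrow> (int \<Rightarrow> 'm) \<Rightarrow> bool" where
  "exact_complex C X d \<longleftrightarrow> complex_in C X d \<and> (\<forall>n. exact_at C (d n) (d (n + 1)))"

text \<open>Exactness at \<open>Hom(X n, Q)\<close> of the complex of abelian groups
  \<open>Hom(X (n + 1), Q) \<rightarrow> Hom(X n, Q) \<rightarrow> Hom(X (n - 1), Q)\<close>: kernel equals image.\<close>

definition Hom_complex_exact :: "('o, 'm) cat \<Rightarrow> (int \<Rightarrow> 'o) \<Rightarrow> (int \<Rightarrow> 'm) \<Rightarrow> 'o \<Rightarrow> bool" where
  "Hom_complex_exact C X d Q \<longleftrightarrow>
     (\<forall>n. {g \<in> Hom C (X n) Q. zero_arr C (g \<cdot>\<^bsub>C\<^esub> d (n - 1))} =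
          (\<lambda>h. h \<cdot>\<^bsub>C\<^esub> d n) ` Hom C (X (n + 1)) Q)"

definition Gorenstein_projective :: "('o, 'm) cat \<Rightarrow> 'o \<Rightarrow> bool" where
  "Gorenstein_projective C M \<longleftrightarrow> M \<in> Obj C \<and>
     (\<exists>X d. exact_complex C X d \<and>
            (\<forall>n. projective_object C (X n)) \<and>
            (\<exists>k. is_kernel C k (d 0) \<and> isomorphic C M (Dom C k)) \<and>
            (\<forall>Q. projective_object C Q \<longrightarrow> Hom_complex_exact C X d Q))"

definition GP :: "('o, 'm) cat \<Rightarrow> 'o set" where
  "GP C = {M. Gorenstein_projective C M}"


section \<open>Precovers\<close>

definition is_precover :: "('o, 'm) cat \<Rightarrow> 'o set \<Rightarrow> 'o \<Rightarrow> 'm \<Rightarrow> bool" where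
  "is_precover C \<X> M \<phi> \<longleftrightarrow>
     (\<exists>X \<in> \<X>. \<phi> \<in> Hom C X M \<and>
        (\<forall>X' \<in> \<X>. \<forall>f \<in> Hom C X' M. \<exists>g \<in> Hom C X' X. \<phi> \<cdot>\<^bsub>C\<^esub> g = f))"

definition precovering :: "('o, 'm) cat \<Rightarrow> 'o set \<Rightarrow> bool" where
  "precovering C \<X> \<longleftrightarrow> (\<forall>M \<in> Obj C. \<exists>\<phi>. is_precover C \<X> M \<phi>)"

end

theory Submission
  imports Defs
begin

text \<open>By symmetry of the Frobenius condition it suffices to treat one of the two implications, say
  the one for a separable \<open>F\<close>. Two independent ideas carry it.

  \<^item> \<open>F\<close> and \<open>G\<close> preserve Gorenstein projective objects. Each is a left and a right adjoint of the
    other. As left adjoints they preserve epimorphisms and cokernels, as right adjoints they preserve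
    kernels, and they preserve zero objects because these are both initial and terminal; so they are
    exact. A left adjoint of a functor that preserves epimorphisms preserves projective objects.
    Hence \<open>F\<close> sends an exact complex of projectives \<open>P\<close> to another one. The group \<open>Hom (F P, Q)\<close> is
    identified by the adjunction with \<open>Hom (P, G Q)\<close>, which is exact for projective \<open>Q\<close> because
    \<open>G Q\<close> is projective again.

  \<^item> Since \<open>F\<close> is separable with right adjoint \<open>G\<close>, every component \<open>\<eta> M : M \<rightarrow> G F M\<close> of the unit
    has a left inverse \<open>\<nu>\<close> (the easy half of Rafael's theorem). Now let \<open>\<pi> : X \<rightarrow> F M\<close> be a precover
    by a Gorenstein projective object. Then \<open>\<nu> \<circ> G \<pi> : G X \<rightarrow> M\<close> is a precover of \<open>M\<close>: for
    \<open>f : X' \<rightarrow> M\<close> with \<open>X'\<close> Gorenstein projective, \<open>F f\<close> lifts along \<open>\<pi>\<close> to some \<open>g : F X' \<rightarrow> X\<close>, and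
    the adjoint transpose of \<open>g\<close> lifts \<open>f\<close>, because
    \<open>\<nu> \<circ> G \<pi> \<circ> G g \<circ> \<eta> X' = \<nu> \<circ> G F f \<circ> \<eta> X' = \<nu> \<circ> \<eta> M \<circ> f = f\<close>.\<close>

section \<open>Hom-sets and functors\<close>

lemma Hom_Arr: "f \<in> Hom C A B \<Longrightarrow> f \<in> Arr C"
  and Hom_Dom: "f \<in> Hom C A B \<Longrightarrow> Dom C f = A"
  and Hom_Cod: "f \<in> Hom C A B \<Longrightarrow> Cod C f = B"
  by (simp_all add: Hom_def)

lemma Arr_Hom: "f \<in> Arr C \<Longrightarrow> f \<in> Hom C (Dom C f) (Cod C f)"
  by (simp add: Hom_def)

lemma (in category) Hom_Obj:
  assumes "f \<in> Hom C A B"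
  shows "A \<in> Obj C" and "B \<in> Obj C"
  using assms Dom_Obj Cod_Obj by (auto simp: Hom_def)

lemma zero_arrI:
  assumes "zero_object C Z" "h \<in> Hom C A Z" "g \<in> Hom C Z B" "g \<cdot>\<^bsub>C\<^esub> h \<in> Hom C A B"
  shows "zero_arr C (g \<cdot>\<^bsub>C\<^esub> h)"
  using assms unfolding zero_arr_def by (auto simp: Hom_def)

lemma zero_arrE:
  assumes "zero_arr C f" "f \<in> Hom C A B"
  obtains Z h g where "zero_object C Z" "h \<in> Hom C A Z" "g \<in> Hom C Z B" "f = g \<cdot>\<^bsub>C\<^esub> h"
  using assms unfolding zero_arr_def by (auto simp: Hom_def)

lemma is_kernelI:
  assumes f: "f \<in> Hom C A B" and k: "k \<in> Hom C K A" and "zero_arr C (f \<cdot>\<^bsub>C\<^esub> k)"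
    and univ: "\<And>E h. h \<in> Hom C E A \<Longrightarrow> zero_arr C (f \<cdot>\<^bsub>C\<^esub> h) \<Longrightarrow>
      \<exists>!u. u \<in> Hom C E K \<and> k \<cdot>\<^bsub>C\<^esub> u = h"
  shows "is_kernel C k f"
proof -
  have "\<exists>!u. u \<in> Hom C (Dom C h) K \<and> k \<cdot>\<^bsub>C\<^esub> u = h"
    if "h \<in> Arr C" "Cod C h = A" "zero_arr C (f \<cdot>\<^bsub>C\<^esub> h)" for h
    using univ[of h "Dom C h"] Arr_Hom[OF that(1)] that by fast
  then show ?thesis
    unfolding is_kernel_def Hom_Dom[OF f] Hom_Dom[OF k] Hom_Cod[OF k]
    using assms(3) Hom_Arr[OF f] Hom_Arr[OF k] by blast
qed

lemma is_kernelE: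
  assumes "is_kernel C k f" "h \<in> Hom C E (Dom C f)" "zero_arr C (f \<cdot>\<^bsub>C\<^esub> h)"
  shows "\<exists>!u. u \<in> Hom C E (Dom C k) \<and> k \<cdot>\<^bsub>C\<^esub> u = h"
  using assms(1)[unfolded is_kernel_def] Hom_Arr[OF assms(2)] Hom_Cod[OF assms(2)] assms(3)
  unfolding Hom_Dom[OF assms(2), symmetric] by blast

lemma is_cokernelI:
  assumes f: "f \<in> Hom C A B" and c: "c \<in> Hom C B K" and "zero_arr C (c \<cdot>\<^bsub>C\<^esub> f)"
    and univ: "\<And>E h. h \<in> Hom C B E \<Longrightarrow> zero_arr C (h \<cdot>\<^bsub>C\<^esub> f) \<Longrightarrow>
      \<exists>!u. u \<in> Hom C K E \<and> u \<cdot>\<^bsub>C\<^esub> c = h"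
  shows "is_cokernel C c f"
proof -
  have "\<exists>!u. u \<in> Hom C K (Cod C h) \<and> u \<cdot>\<^bsub>C\<^esub> c = h"
    if "h \<in> Arr C" "Dom C h = B" "zero_arr C (h \<cdot>\<^bsub>C\<^esub> f)" for h
    using univ[of h "Cod C h"] Arr_Hom[OF that(1)] that by fast
  then show ?thesis
    unfolding is_cokernel_def Hom_Cod[OF f] Hom_Dom[OF c] Hom_Cod[OF c]
    using assms(3) Hom_Arr[OF f] Hom_Arr[OF c] by blast
qed

lemma is_cokernelE:
  assumes "is_cokernel C c f" "h \<in> Hom C (Cod C f) E" "zero_arr C (h \<cdot>\<^bsub>C\<^esub> f)"
  shows "\<exists>!u. u \<in> Hom C (Cod C c) E \<and> u \<cdot>\<^bsub>C\<^esub> c = h"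
  using assms(1)[unfolded is_cokernel_def] Hom_Arr[OF assms(2)] Hom_Dom[OF assms(2)] assms(3)
  unfolding Hom_Cod[OF assms(2), symmetric] by blast

lemma (in covariant_functor) preserves_zero_arr:
  assumes zero: "\<And>Z. zero_object C Z \<Longrightarrow> zero_object D (OMap F Z)" and f: "zero_arr C f"
  shows "zero_arr D (AMap F f)"
proof -
  from f have fH: "f \<in> Hom C (Dom C f) (Cod C f)"
    by (simp add: zero_arr_def Arr_Hom)
  from f fH obtain Z h g where Z: "zero_object C Z"
    and h: "h \<in> Hom C (Dom C f) Z" and g: "g \<in> Hom C Z (Cod C f)" and eq: "f = g \<cdot>\<^bsub>C\<^esub> h"
    by (rule zero_arrE)
  have "AMap F f = AMap F g \<cdot>\<^bsub>D\<^esub> AMap F h"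
    using AMap_Comp[OF h g] eq by simp
  with zero_arrI[OF zero[OF Z] AMap_Hom[OF h] AMap_Hom[OF g]] AMap_Hom[OF fH]
  show ?thesis by simp
qed

lemma (in covariant_functor) preserves_isomorphic:
  assumes "isomorphic C A B"
  shows "isomorphic D (OMap F A) (OMap F B)"
proof -
  from assms obtain f g where A: "A \<in> Obj C" and B: "B \<in> Obj C"
    and f: "f \<in> Hom C A B" and g: "g \<in> Hom C B A"
    and gf: "g \<cdot>\<^bsub>C\<^esub> f = Id C A" and fg: "f \<cdot>\<^bsub>C\<^esub> g = Id C B"
    unfolding isomorphic_def by blast
  have "AMap F g \<cdot>\<^bsub>D\<^esub> AMap F f = Id D (OMap F A)"
    using AMap_Comp[OF f g] gf AMap_Id[OF A] by simp
  moreover have "AMap F f \<cdot>\<^bsub>D\<^esub> AMap F g = Id D (OMap F B)"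
    using AMap_Comp[OF g f] fg AMap_Id[OF B] by simp
  ultimately show ?thesis
    unfolding isomorphic_def using AMap_Hom[OF f] AMap_Hom[OF g] OMap_Obj A B by blast
qed

section \<open>Adjunctions\<close>

locale adjunction = left: covariant_functor C D F + right: covariant_functor D C G
  for C :: "('o, 'm) cat" and D :: "('p, 'n) cat"
    and F :: "('o, 'm, 'p, 'n) functr" and G :: "('p, 'n, 'o, 'm) functr" +
  fixes \<theta> :: "'o \<Rightarrow> 'p \<Rightarrow> 'n \<Rightarrow> 'm"
  assumes bij: "A \<in> Obj C \<Longrightarrow> B \<in> Obj D \<Longrightarrow>
      bij_betw (\<theta> A B) (Hom D (OMap F A) B) (Hom C A (OMap G B))"
    and natural_left: "a \<in> Hom C A' A \<Longrightarrow> f \<in> Hom D (OMap F A) B \<Longrightarrow> A \<in> Obj C \<Longrightarrow>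
      \<theta> A' B (f \<cdot>\<^bsub>D\<^esub> AMap F a) = \<theta> A B f \<cdot>\<^bsub>C\<^esub> a"
    and natural_right: "b \<in> Hom D B B' \<Longrightarrow> f \<in> Hom D (OMap F A) B \<Longrightarrow> A \<in> Obj C \<Longrightarrow>
      \<theta> A B' (b \<cdot>\<^bsub>D\<^esub> f) = AMap G b \<cdot>\<^bsub>C\<^esub> \<theta> A B f"

lemma adjoint_pair_adjunction:
  assumes "adjoint_pair C D F G"
  obtains \<theta> where "adjunction C D F G \<theta>"
proof -
  from assms obtain \<theta> where FD: "covariant_functor C D F" and GD: "covariant_functor D C G"
    and b: "\<forall>A \<in> Obj C. \<forall>B \<in> Obj D. bij_betw (\<theta> A B) (Hom D (OMap F A) B) (Hom C A (OMap G B))"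
    and nl: "\<forall>A \<in> Obj C. \<forall>A' \<in> Obj C. \<forall>B \<in> Obj D. \<forall>a \<in> Hom C A' A. \<forall>f \<in> Hom D (OMap F A) B.
             \<theta> A' B (f \<cdot>\<^bsub>D\<^esub> AMap F a) = \<theta> A B f \<cdot>\<^bsub>C\<^esub> a"
    and nr: "\<forall>A \<in> Obj C. \<forall>B \<in> Obj D. \<forall>B' \<in> Obj D. \<forall>b \<in> Hom D B B'. \<forall>f \<in> Hom D (OMap F A) B.
             \<theta> A B' (b \<cdot>\<^bsub>D\<^esub> f) = AMap G b \<cdot>\<^bsub>C\<^esub> \<theta> A B f"
    unfolding adjoint_pair_def by blast
  interpret left: covariant_functor C D F by (rule FD)
  interpret right: covariant_functor D C G by (rule GD)
  have "adjunction C D F G \<theta>"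
  proof
    fix A B assume "A \<in> Obj C" "B \<in> Obj D"
    with b show "bij_betw (\<theta> A B) (Hom D (OMap F A) B) (Hom C A (OMap G B))" by blast
  next
    fix a A' A f B assume "a \<in> Hom C A' A" "f \<in> Hom D (OMap F A) B" "A \<in> Obj C"
    with nl left.source.Hom_Obj left.target.Hom_Obj
    show "\<theta> A' B (f \<cdot>\<^bsub>D\<^esub> AMap F a) = \<theta> A B f \<cdot>\<^bsub>C\<^esub> a" by blast
  next
    fix b B B' f A assume "b \<in> Hom D B B'" "f \<in> Hom D (OMap F A) B" "A \<in> Obj C"
    with nr left.source.Hom_Obj left.target.Hom_Obj
    show "\<theta> A B' (b \<cdot>\<^bsub>D\<^esub> f) = AMap G b \<cdot>\<^bsub>C\<^esub> \<theta> A B f" by blast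
  qed
  then show thesis by (rule that)
qed

context adjunction
begin

definition \<theta>inv :: "'o \<Rightarrow> 'p \<Rightarrow> 'm \<Rightarrow> 'n" where
  "\<theta>inv A B = inv_into (Hom D (OMap F A) B) (\<theta> A B)"

lemma \<theta>_Hom: "f \<in> Hom D (OMap F A) B \<Longrightarrow> A \<in> Obj C \<Longrightarrow> \<theta> A B f \<in> Hom C A (OMap G B)"
  using bij[of A B] left.target.Hom_Obj[of f] by (auto dest: bij_betwE)

lemma \<theta>inv_\<theta>: "f \<in> Hom D (OMap F A) B \<Longrightarrow> A \<in> Obj C \<Longrightarrow> \<theta>inv A B (\<theta> A B f) = f"
  unfolding \<theta>inv_def using bij[of A B] left.target.Hom_Obj[of f]
  by (metis bij_betw_inv_into_left)

lemma \<theta>inv_Hom: "g \<in> Hom C A (OMap G B) \<Longrightarrow> B \<in> Obj D \<Longrightarrow> \<theta>inv A B g \<in> Hom D (OMap F A) B"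
  unfolding \<theta>inv_def using bij[of A B] left.source.Hom_Obj[of g]
  by (metis bij_betw_imp_surj_on inv_into_into)

lemma \<theta>_\<theta>inv: "g \<in> Hom C A (OMap G B) \<Longrightarrow> B \<in> Obj D \<Longrightarrow> \<theta> A B (\<theta>inv A B g) = g"
  unfolding \<theta>inv_def using bij[of A B] left.source.Hom_Obj[of g]
  by (metis bij_betw_inv_into_right)

lemma \<theta>_inject:
  "f \<in> Hom D (OMap F A) B \<Longrightarrow> f' \<in> Hom D (OMap F A) B \<Longrightarrow> A \<in> Obj C \<Longrightarrow> \<theta> A B f = \<theta> A B f' \<Longrightarrow> f = f'"
  by (metis \<theta>inv_\<theta>)

lemma \<theta>inv_inject:
  "g \<in> Hom C A (OMap G B) \<Longrightarrow> g' \<in> Hom C A (OMap G B) \<Longrightarrow> B \<in> Obj D \<Longrightarrow>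
    \<theta>inv A B g = \<theta>inv A B g' \<Longrightarrow> g = g'"
  by (metis \<theta>_\<theta>inv)

lemma natural_left_inv:
  assumes a: "a \<in> Hom C A' A" and g: "g \<in> Hom C A (OMap G B)" and B: "B \<in> Obj D"
  shows "\<theta>inv A' B (g \<cdot>\<^bsub>C\<^esub> a) = \<theta>inv A B g \<cdot>\<^bsub>D\<^esub> AMap F a"
proof -
  note A = left.source.Hom_Obj[OF a] and f = \<theta>inv_Hom[OF g B]
  have "\<theta> A' B (\<theta>inv A B g \<cdot>\<^bsub>D\<^esub> AMap F a) = g \<cdot>\<^bsub>C\<^esub> a"
    using natural_left[OF a f A(2)] \<theta>_\<theta>inv[OF g B] by simp
  with \<theta>inv_\<theta>[OF left.target.Comp_Hom[OF left.AMap_Hom[OF a] f] A(1)] show ?thesis by simp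
qed

lemma natural_right_inv:
  assumes b: "b \<in> Hom D B B'" and g: "g \<in> Hom C A (OMap G B)"
  shows "\<theta>inv A B' (AMap G b \<cdot>\<^bsub>C\<^esub> g) = b \<cdot>\<^bsub>D\<^esub> \<theta>inv A B g"
proof -
  note A = left.source.Hom_Obj(1)[OF g]
  have f: "\<theta>inv A B g \<in> Hom D (OMap F A) B"
    using \<theta>inv_Hom[OF g] left.target.Hom_Obj[OF b] by blast
  have "\<theta> A B' (b \<cdot>\<^bsub>D\<^esub> \<theta>inv A B g) = AMap G b \<cdot>\<^bsub>C\<^esub> g"
    using natural_right[OF b f A] \<theta>_\<theta>inv[OF g] left.target.Hom_Obj[OF b] by simp
  with \<theta>inv_\<theta>[OF left.target.Comp_Hom[OF f b] A] show ?thesis by simp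
qed

lemma left_preserves_initial:
  assumes Z: "Z \<in> Obj C" and init: "\<And>A. A \<in> Obj C \<Longrightarrow> \<exists>!f. f \<in> Hom C Z A" and B: "B \<in> Obj D"
  shows "\<exists>!f. f \<in> Hom D (OMap F Z) B"
proof -
  from init[OF right.OMap_Obj[OF B]] obtain g where g: "g \<in> Hom C Z (OMap G B)"
    and "\<And>g'. g' \<in> Hom C Z (OMap G B) \<Longrightarrow> g' = g" by blast
  then show ?thesis
    using \<theta>inv_Hom[OF g B] \<theta>_Hom \<theta>_inject Z by metis
qed

lemma right_preserves_terminal:
  assumes Z: "Z \<in> Obj D" and terminal: "\<And>B. B \<in> Obj D \<Longrightarrow> \<exists>!f. f \<in> Hom D B Z" and A: "A \<in> Obj C"
  shows "\<exists>!f. f \<in> Hom C A (OMap G Z)"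
proof -
  from terminal[OF left.OMap_Obj[OF A]] obtain f where f: "f \<in> Hom D (OMap F A) Z"
    and "\<And>f'. f' \<in> Hom D (OMap F A) Z \<Longrightarrow> f' = f" by blast
  then show ?thesis
    using \<theta>_Hom[OF f A] \<theta>inv_Hom \<theta>inv_inject Z by metis
qed

text \<open>Cancellation of \<open>F e\<close> transposes to cancellation of \<open>e\<close>.\<close>

lemma left_preserves_epi:
  assumes "epi_arr C e"
  shows "epi_arr D (AMap F e)"
proof -
  define A B where "A = Dom C e" and "B = Cod C e"
  from assms have e: "e \<in> Hom C A B"
    by (simp add: epi_arr_def A_def B_def Arr_Hom)
  have canc: "g = h" if "g \<in> Hom C B E" "h \<in> Hom C B E" "g \<cdot>\<^bsub>C\<^esub> e = h \<cdot>\<^bsub>C\<^esub> e" for g h E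
    using assms that left.source.Hom_Obj unfolding epi_arr_def B_def by blast
  note B = left.source.Hom_Obj(2)[OF e] and Fe = left.AMap_Hom[OF e]
  have "g = h" if g: "g \<in> Hom D (OMap F B) E" and h: "h \<in> Hom D (OMap F B) E"
    and eq: "g \<cdot>\<^bsub>D\<^esub> AMap F e = h \<cdot>\<^bsub>D\<^esub> AMap F e" for g h E
  proof -
    have "\<theta> B E g \<cdot>\<^bsub>C\<^esub> e = \<theta> B E h \<cdot>\<^bsub>C\<^esub> e"
      using natural_left[OF e g B] natural_left[OF e h B] eq by simp
    then have "\<theta> B E g = \<theta> B E h"
      using canc \<theta>_Hom g h B by blast
    with g h B show ?thesis by (rule_tac \<theta>_inject)
  qed
  then show ?thesis
    unfolding epi_arr_def using Hom_Arr[OF Fe] Hom_Cod[OF Fe] by simp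
qed

text \<open>A lifting problem out of \<open>F P\<close> transposes to one out of \<open>P\<close>, against the epimorphism \<open>G e\<close>.\<close>

lemma left_preserves_projective:
  assumes epi: "\<And>e. epi_arr D e \<Longrightarrow> epi_arr C (AMap G e)" and P: "projective_object C P"
  shows "projective_object D (OMap F P)"
  unfolding projective_object_def
proof (intro conjI allI impI)
  from P have PO: "P \<in> Obj C" by (simp add: projective_object_def)
  then show "OMap F P \<in> Obj D" by (rule left.OMap_Obj)
  fix e f assume "epi_arr D e \<and> f \<in> Hom D (OMap F P) (Cod D e)"
  then have e: "epi_arr D e" and f: "f \<in> Hom D (OMap F P) (Cod D e)" by auto
  from e have eH: "e \<in> Hom D (Dom D e) (Cod D e)" by (simp add: epi_arr_def Arr_Hom)
  note Ge = right.AMap_Hom[OF eH]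
  have "\<theta> P (Cod D e) f \<in> Hom C P (Cod C (AMap G e))"
    using \<theta>_Hom[OF f PO] Hom_Cod[OF Ge] by simp
  with P epi[OF e] obtain g where "g \<in> Hom C P (Dom C (AMap G e))"
    and eq: "AMap G e \<cdot>\<^bsub>C\<^esub> g = \<theta> P (Cod D e) f"
    unfolding projective_object_def by blast
  then have g: "g \<in> Hom C P (OMap G (Dom D e))" using Hom_Dom[OF Ge] by simp
  have "e \<cdot>\<^bsub>D\<^esub> \<theta>inv P (Dom D e) g = f"
    using natural_right_inv[OF eH g] \<theta>inv_\<theta>[OF f PO] eq by simp
  then show "\<exists>g \<in> Hom D (OMap F P) (Dom D e). e \<cdot>\<^bsub>D\<^esub> g = f"
    using \<theta>inv_Hom[OF g] left.target.Hom_Obj(1)[OF eH] by blast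
qed

text \<open>The left inverse is the image of the counit \<open>F G F M \<rightarrow> F M\<close> under the maps that witness
  separability. Their compatibility with commutative squares, applied to the triangle identity, turns
  it into an inverse of the unit.\<close>

lemma separable_unit_split:
  assumes "separable_functor C D F" and M: "M \<in> Obj C"
  obtains \<nu> where "\<nu> \<in> Hom C (OMap G (OMap F M)) M"
    and "\<nu> \<cdot>\<^bsub>C\<^esub> \<theta> M (OMap F M) (Id D (OMap F M)) = Id C M"
proof -
  from assms(1) obtain \<phi> where
    \<phi>_Hom: "\<forall>M \<in> Obj C. \<forall>N \<in> Obj C. \<forall>f \<in> Hom D (OMap F M) (OMap F N). \<phi> M N f \<in> Hom C M N"
    and \<phi>_F: "\<forall>M \<in> Obj C. \<forall>N \<in> Obj C. \<forall>h \<in> Hom C M N. \<phi> M N (AMap F h) = h"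
    and \<phi>_square: "\<forall>M \<in> Obj C. \<forall>N \<in> Obj C. \<forall>M' \<in> Obj C. \<forall>N' \<in> Obj C.
       \<forall>\<alpha> \<in> Hom C M M'. \<forall>\<beta> \<in> Hom C N N'.
       \<forall>f \<in> Hom D (OMap F M) (OMap F N). \<forall>g \<in> Hom D (OMap F M') (OMap F N').
         AMap F \<beta> \<cdot>\<^bsub>D\<^esub> f = g \<cdot>\<^bsub>D\<^esub> AMap F \<alpha> \<longrightarrow> \<beta> \<cdot>\<^bsub>C\<^esub> \<phi> M N f = \<phi> M' N' g \<cdot>\<^bsub>C\<^esub> \<alpha>"
    unfolding separable_functor_def by blast
  let ?FM = "OMap F M" and ?GFM = "OMap G (OMap F M)"
  note FM = left.OMap_Obj[OF M]
  note GFM = right.OMap_Obj[OF FM]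
  note idM = left.source.Id_Hom[OF M] and idFM = left.target.Id_Hom[OF FM]
  note idGFM = left.source.Id_Hom[OF GFM]
  define \<eta> where "\<eta> = \<theta> M ?FM (Id D ?FM)"
  define \<epsilon> where "\<epsilon> = \<theta>inv ?GFM ?FM (Id C ?GFM)"
  have \<eta>: "\<eta> \<in> Hom C M ?GFM" unfolding \<eta>_def by (rule \<theta>_Hom[OF idFM M])
  have \<epsilon>: "\<epsilon> \<in> Hom D (OMap F ?GFM) ?FM" unfolding \<epsilon>_def by (rule \<theta>inv_Hom[OF idGFM FM])
  have triangle: "\<epsilon> \<cdot>\<^bsub>D\<^esub> AMap F \<eta> = Id D ?FM"
  proof -
    have "\<epsilon> \<cdot>\<^bsub>D\<^esub> AMap F \<eta> = \<theta>inv M ?FM (Id C ?GFM \<cdot>\<^bsub>C\<^esub> \<eta>)"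
      unfolding \<epsilon>_def using natural_left_inv[OF \<eta> idGFM FM] by simp
    also have "\<dots> = Id D ?FM"
      using left.source.Id_Comp[OF \<eta>] \<theta>inv_\<theta>[OF idFM M] by (simp add: \<eta>_def)
    finally show ?thesis .
  qed
  have "Id C M \<cdot>\<^bsub>C\<^esub> \<phi> M M (Id D ?FM) = \<phi> ?GFM M \<epsilon> \<cdot>\<^bsub>C\<^esub> \<eta>"
    using triangle left.AMap_Id[OF M] left.target.Comp_Id[OF idFM]
    by (intro \<phi>_square[rule_format] M GFM \<eta> idM idFM \<epsilon>) simp
  moreover have "\<phi> M M (Id D ?FM) = Id C M"
    using \<phi>_F[rule_format, OF M M idM] left.AMap_Id[OF M] by simp
  ultimately have "\<phi> ?GFM M \<epsilon> \<cdot>\<^bsub>C\<^esub> \<eta> = Id C M"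
    using left.source.Comp_Id[OF idM] by simp
  with \<phi>_Hom[rule_format, OF GFM M \<epsilon>] that show thesis unfolding \<eta>_def by blast
qed

text \<open>The precover is \<open>\<nu> \<circ> G \<pi>\<close>, where \<open>\<nu>\<close> splits the unit at \<open>M\<close> and \<open>\<pi>\<close> is a precover of \<open>F M\<close>.\<close>

lemma separable_precovering:
  assumes sep: "separable_functor C D F" and pre: "precovering D \<Y>"
    and F\<X>: "\<And>X. X \<in> \<X> \<Longrightarrow> OMap F X \<in> \<Y>" and G\<Y>: "\<And>Y. Y \<in> \<Y> \<Longrightarrow> OMap G Y \<in> \<X>"
  shows "precovering C \<X>"
  unfolding precovering_def
proof
  fix M assume M: "M \<in> Obj C"
  note FM = left.OMap_Obj[OF M]
  note idFM = left.target.Id_Hom[OF FM]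
  from sep M obtain \<nu> where \<nu>: "\<nu> \<in> Hom C (OMap G (OMap F M)) M"
    and split: "\<nu> \<cdot>\<^bsub>C\<^esub> \<theta> M (OMap F M) (Id D (OMap F M)) = Id C M"
    by (rule separable_unit_split)
  note \<eta> = \<theta>_Hom[OF idFM M]
  from pre FM obtain Y \<pi> where Y: "Y \<in> \<Y>" and \<pi>: "\<pi> \<in> Hom D Y (OMap F M)"
    and lift: "\<And>Y' f. Y' \<in> \<Y> \<Longrightarrow> f \<in> Hom D Y' (OMap F M) \<Longrightarrow> \<exists>g \<in> Hom D Y' Y. \<pi> \<cdot>\<^bsub>D\<^esub> g = f"
    unfolding precovering_def is_precover_def by blast
  note G\<pi> = right.AMap_Hom[OF \<pi>]
  have "is_precover C \<X> M (\<nu> \<cdot>\<^bsub>C\<^esub> AMap G \<pi>)"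
    unfolding is_precover_def
  proof (rule bexI[of _ "OMap G Y"], intro conjI ballI)
    show "OMap G Y \<in> \<X>" by (rule G\<Y>[OF Y])
    show "\<nu> \<cdot>\<^bsub>C\<^esub> AMap G \<pi> \<in> Hom C (OMap G Y) M"
      by (rule left.source.Comp_Hom[OF G\<pi> \<nu>])
    fix X' f assume X': "X' \<in> \<X>" and f: "f \<in> Hom C X' M"
    note X'O = left.source.Hom_Obj(1)[OF f] and Ff = left.AMap_Hom[OF f]
    from lift[OF F\<X>[OF X'] Ff] obtain g where g: "g \<in> Hom D (OMap F X') Y"
      and eq: "\<pi> \<cdot>\<^bsub>D\<^esub> g = AMap F f" by blast
    note tg = \<theta>_Hom[OF g X'O]
    have "AMap G \<pi> \<cdot>\<^bsub>C\<^esub> \<theta> X' Y g = \<theta> X' (OMap F M) (Id D (OMap F M) \<cdot>\<^bsub>D\<^esub> AMap F f)"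
      using natural_right[OF \<pi> g X'O] eq left.target.Id_Comp[OF Ff] by simp
    also have "\<dots> = \<theta> M (OMap F M) (Id D (OMap F M)) \<cdot>\<^bsub>C\<^esub> f"
      by (rule natural_left[OF f idFM M])
    finally have "(\<nu> \<cdot>\<^bsub>C\<^esub> AMap G \<pi>) \<cdot>\<^bsub>C\<^esub> \<theta> X' Y g
        = \<nu> \<cdot>\<^bsub>C\<^esub> (\<theta> M (OMap F M) (Id D (OMap F M)) \<cdot>\<^bsub>C\<^esub> f)"
      using left.source.Comp_assoc[OF tg G\<pi> \<nu>] by simp
    also have "\<dots> = f"
      using left.source.Comp_assoc[OF f \<eta> \<nu>] split left.source.Id_Comp[OF f] by simp
    finally have "(\<nu> \<cdot>\<^bsub>C\<^esub> AMap G \<pi>) \<cdot>\<^bsub>C\<^esub> \<theta> X' Y g = f" .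
    with tg show "\<exists>g \<in> Hom C X' (OMap G Y). (\<nu> \<cdot>\<^bsub>C\<^esub> AMap G \<pi>) \<cdot>\<^bsub>C\<^esub> g = f" by blast
  qed
  then show "\<exists>\<phi>. is_precover C \<X> M \<phi>" ..
qed

end

section \<open>Adjunctions that preserve zero objects\<close>

text \<open>Zero arrows factor through a zero object, so a functor between categories without a chosen
  enrichment sends them to zero arrows once it preserves zero objects.\<close>

locale zero_preserving_adjunction = adjunction C D F G \<theta>
  for C :: "('o, 'm) cat" and D :: "('p, 'n) cat" and F G \<theta> +
  assumes left_zero: "zero_object C Z \<Longrightarrow> zero_object D (OMap F Z)"
    and right_zero: "zero_object D W \<Longrightarrow> zero_object C (OMap G W)"
begin

lemma \<theta>_zero_iff:
  assumes f: "f \<in> Hom D (OMap F A) B" and A: "A \<in> Obj C"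
  shows "zero_arr C (\<theta> A B f) \<longleftrightarrow> zero_arr D f"
proof
  note B = left.target.Hom_Obj(2)[OF f]
  assume "zero_arr C (\<theta> A B f)"
  then obtain Z h g where Z: "zero_object C Z" and h: "h \<in> Hom C A Z"
    and g: "g \<in> Hom C Z (OMap G B)" and eq: "\<theta> A B f = g \<cdot>\<^bsub>C\<^esub> h"
    using \<theta>_Hom[OF f A] by (rule zero_arrE)
  have "f = \<theta>inv Z B g \<cdot>\<^bsub>D\<^esub> AMap F h"
    using natural_left_inv[OF h g B] eq \<theta>inv_\<theta>[OF f A] by simp
  with zero_arrI[OF left_zero[OF Z] left.AMap_Hom[OF h] \<theta>inv_Hom[OF g B]] f
  show "zero_arr D f" by simp
next
  assume "zero_arr D f"
  then obtain Z h g where Z: "zero_object D Z" and h: "h \<in> Hom D (OMap F A) Z"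
    and g: "g \<in> Hom D Z B" and eq: "f = g \<cdot>\<^bsub>D\<^esub> h"
    using f by (rule zero_arrE)
  have "\<theta> A B f = AMap G g \<cdot>\<^bsub>C\<^esub> \<theta> A Z h"
    using natural_right[OF g h A] eq by simp
  with zero_arrI[OF right_zero[OF Z] \<theta>_Hom[OF h A] right.AMap_Hom[OF g]] \<theta>_Hom[OF f A]
  show "zero_arr C (\<theta> A B f)" by simp
qed

lemma \<theta>inv_zero_iff:
  assumes g: "g \<in> Hom C A (OMap G B)" and B: "B \<in> Obj D"
  shows "zero_arr D (\<theta>inv A B g) \<longleftrightarrow> zero_arr C g"
  using \<theta>_zero_iff[OF \<theta>inv_Hom[OF g B] left.source.Hom_Obj(1)[OF g]] \<theta>_\<theta>inv[OF g B] by simp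

text \<open>The arrows from \<open>F B\<close> to \<open>E\<close> that kill \<open>F f\<close> are the transposes of those from \<open>B\<close> to \<open>G E\<close> that
  kill \<open>f\<close>, so the universal property of \<open>c\<close> at \<open>G E\<close> is the one of \<open>F c\<close> at \<open>E\<close>.\<close>

lemma left_preserves_cokernel:
  assumes "is_cokernel C c f"
  shows "is_cokernel D (AMap F c) (AMap F f)"
proof -
  define A B K where "A = Dom C f" and "B = Cod C f" and "K = Cod C c"
  from assms have f: "f \<in> Hom C A B" and c: "c \<in> Hom C B K" and z: "zero_arr C (c \<cdot>\<^bsub>C\<^esub> f)"
    unfolding is_cokernel_def A_def B_def K_def by (auto simp: Hom_def)
  note B = left.source.Hom_Obj(2)[OF f] and K = left.source.Hom_Obj(2)[OF c]
  note Ff = left.AMap_Hom[OF f] and Fc = left.AMap_Hom[OF c]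
  show ?thesis
  proof (rule is_cokernelI[OF Ff Fc])
    show "zero_arr D (AMap F c \<cdot>\<^bsub>D\<^esub> AMap F f)"
      using left.preserves_zero_arr[OF left_zero z] left.AMap_Comp[OF f c] by simp
    fix E h assume h: "h \<in> Hom D (OMap F B) E" and hz: "zero_arr D (h \<cdot>\<^bsub>D\<^esub> AMap F f)"
    note E = left.target.Hom_Obj(2)[OF h] and A = left.source.Hom_Obj(1)[OF f]
    have "zero_arr C (\<theta> B E h \<cdot>\<^bsub>C\<^esub> f)"
      using \<theta>_zero_iff[OF left.target.Comp_Hom[OF Ff h] A] hz natural_left[OF f h B] by simp
    with is_cokernelE[OF assms, of "\<theta> B E h" "OMap G E"] \<theta>_Hom[OF h B]
    have "\<exists>!u. u \<in> Hom C K (OMap G E) \<and> u \<cdot>\<^bsub>C\<^esub> c = \<theta> B E h"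
      by (simp add: B_def K_def)
    then obtain u where u: "u \<in> Hom C K (OMap G E)" and ueq: "u \<cdot>\<^bsub>C\<^esub> c = \<theta> B E h"
      and uniq: "\<And>v. v \<in> Hom C K (OMap G E) \<Longrightarrow> v \<cdot>\<^bsub>C\<^esub> c = \<theta> B E h \<Longrightarrow> v = u" by blast
    show "\<exists>!u. u \<in> Hom D (OMap F K) E \<and> u \<cdot>\<^bsub>D\<^esub> AMap F c = h"
    proof (rule ex1I[of _ "\<theta>inv K E u"], intro conjI)
      show "\<theta>inv K E u \<in> Hom D (OMap F K) E" by (rule \<theta>inv_Hom[OF u E])
      show "\<theta>inv K E u \<cdot>\<^bsub>D\<^esub> AMap F c = h"
        using natural_left_inv[OF c u E] ueq \<theta>inv_\<theta>[OF h B] by simp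
      fix v assume v: "v \<in> Hom D (OMap F K) E \<and> v \<cdot>\<^bsub>D\<^esub> AMap F c = h"
      then have "\<theta> K E v = u"
        using natural_left[OF c _ K] by (intro uniq \<theta>_Hom K) auto
      with v show "v = \<theta>inv K E u" using \<theta>inv_\<theta> K by auto
    qed
  qed
qed

lemma right_preserves_kernel:
  assumes "is_kernel D k f"
  shows "is_kernel C (AMap G k) (AMap G f)"
proof -
  define A B K where "A = Dom D f" and "B = Cod D f" and "K = Dom D k"
  from assms have f: "f \<in> Hom D A B" and k: "k \<in> Hom D K A" and z: "zero_arr D (f \<cdot>\<^bsub>D\<^esub> k)"
    unfolding is_kernel_def A_def B_def K_def by (auto simp: Hom_def)
  note A = left.target.Hom_Obj(1)[OF f] and B = left.target.Hom_Obj(2)[OF f]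
    and K = left.target.Hom_Obj(1)[OF k]
  note Gf = right.AMap_Hom[OF f] and Gk = right.AMap_Hom[OF k]
  show ?thesis
  proof (rule is_kernelI[OF Gf Gk])
    show "zero_arr C (AMap G f \<cdot>\<^bsub>C\<^esub> AMap G k)"
      using right.preserves_zero_arr[OF right_zero z] right.AMap_Comp[OF k f] by simp
    fix E h assume h: "h \<in> Hom C E (OMap G A)" and hz: "zero_arr C (AMap G f \<cdot>\<^bsub>C\<^esub> h)"
    note E = left.source.Hom_Obj(1)[OF h]
    have "zero_arr D (f \<cdot>\<^bsub>D\<^esub> \<theta>inv E A h)"
      using \<theta>inv_zero_iff[OF left.source.Comp_Hom[OF h Gf] B] hz natural_right_inv[OF f h] by simp
    with is_kernelE[OF assms, of "\<theta>inv E A h" "OMap F E"] \<theta>inv_Hom[OF h A]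
    have "\<exists>!u. u \<in> Hom D (OMap F E) K \<and> k \<cdot>\<^bsub>D\<^esub> u = \<theta>inv E A h"
      by (simp add: A_def K_def)
    then obtain u where u: "u \<in> Hom D (OMap F E) K" and ueq: "k \<cdot>\<^bsub>D\<^esub> u = \<theta>inv E A h"
      and uniq: "\<And>v. v \<in> Hom D (OMap F E) K \<Longrightarrow> k \<cdot>\<^bsub>D\<^esub> v = \<theta>inv E A h \<Longrightarrow> v = u" by blast
    show "\<exists>!u. u \<in> Hom C E (OMap G K) \<and> AMap G k \<cdot>\<^bsub>C\<^esub> u = h"
    proof (rule ex1I[of _ "\<theta> E K u"], intro conjI)
      show "\<theta> E K u \<in> Hom C E (OMap G K)" by (rule \<theta>_Hom[OF u E])
      show "AMap G k \<cdot>\<^bsub>C\<^esub> \<theta> E K u = h"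
        using natural_right[OF k u E] ueq \<theta>_\<theta>inv[OF h A] by simp
      fix v assume v: "v \<in> Hom C E (OMap G K) \<and> AMap G k \<cdot>\<^bsub>C\<^esub> v = h"
      then have "\<theta>inv E K v = u"
        using natural_right_inv[OF k] by (intro uniq \<theta>inv_Hom K) auto
      with v show "v = \<theta> E K u" using \<theta>_\<theta>inv K by auto
    qed
  qed
qed

text \<open>Transposition identifies \<open>Hom (F X, Q)\<close> with \<open>Hom (X, G Q)\<close> as complexes of pointed sets, and
  exactness only refers to that structure.\<close>

lemma left_Hom_complex_exact:
  assumes X: "\<And>n. X n \<in> Obj C" and d: "\<And>n. d n \<in> Hom C (X n) (X (n + 1))" and Q: "Q \<in> Obj D"
    and ex: "Hom_complex_exact C X d (OMap G Q)"
  shows "Hom_complex_exact D (\<lambda>n. OMap F (X n)) (\<lambda>n. AMap F (d n)) Q"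
  unfolding Hom_complex_exact_def
proof (intro allI equalityI subsetI)
  fix n g
  assume "g \<in> {g \<in> Hom D (OMap F (X n)) Q. zero_arr D (g \<cdot>\<^bsub>D\<^esub> AMap F (d (n - 1)))}"
  then have g: "g \<in> Hom D (OMap F (X n)) Q" and z: "zero_arr D (g \<cdot>\<^bsub>D\<^esub> AMap F (d (n - 1)))" by auto
  have d': "d (n - 1) \<in> Hom C (X (n - 1)) (X n)" using d[of "n - 1"] by simp
  have "zero_arr C (\<theta> (X n) Q g \<cdot>\<^bsub>C\<^esub> d (n - 1))"
    using \<theta>_zero_iff[OF left.target.Comp_Hom[OF left.AMap_Hom[OF d'] g] X] natural_left[OF d' g X] z
    by simp
  then have "\<theta> (X n) Q g \<in> {g \<in> Hom C (X n) (OMap G Q). zero_arr C (g \<cdot>\<^bsub>C\<^esub> d (n - 1))}"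
    using \<theta>_Hom[OF g X] by simp
  then have "\<theta> (X n) Q g \<in> (\<lambda>h. h \<cdot>\<^bsub>C\<^esub> d n) ` Hom C (X (n + 1)) (OMap G Q)"
    unfolding ex[unfolded Hom_complex_exact_def, rule_format] .
  then obtain h where eq: "\<theta> (X n) Q g = h \<cdot>\<^bsub>C\<^esub> d n" and h: "h \<in> Hom C (X (n + 1)) (OMap G Q)"
    by (rule imageE)
  have "g = \<theta>inv (X (n + 1)) Q h \<cdot>\<^bsub>D\<^esub> AMap F (d n)"
    using natural_left_inv[OF d h Q] eq \<theta>inv_\<theta>[OF g X] by simp
  then show "g \<in> (\<lambda>h. h \<cdot>\<^bsub>D\<^esub> AMap F (d n)) ` Hom D (OMap F (X (n + 1))) Q"
    using \<theta>inv_Hom[OF h Q] by (rule image_eqI)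
next
  fix n g
  assume "g \<in> (\<lambda>h. h \<cdot>\<^bsub>D\<^esub> AMap F (d n)) ` Hom D (OMap F (X (n + 1))) Q"
  then obtain h where eq: "g = h \<cdot>\<^bsub>D\<^esub> AMap F (d n)" and h: "h \<in> Hom D (OMap F (X (n + 1))) Q"
    by (rule imageE)
  have g: "g \<in> Hom D (OMap F (X n)) Q"
    using left.target.Comp_Hom[OF left.AMap_Hom[OF d] h] eq by simp
  have d': "d (n - 1) \<in> Hom C (X (n - 1)) (X n)" using d[of "n - 1"] by simp
  have "\<theta> (X n) Q g = \<theta> (X (n + 1)) Q h \<cdot>\<^bsub>C\<^esub> d n"
    using natural_left[OF d h X] eq by simp
  then have "\<theta> (X n) Q g \<in> (\<lambda>h. h \<cdot>\<^bsub>C\<^esub> d n) ` Hom C (X (n + 1)) (OMap G Q)"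
    using \<theta>_Hom[OF h X] by (rule image_eqI)
  then have "zero_arr C (\<theta> (X n) Q g \<cdot>\<^bsub>C\<^esub> d (n - 1))"
    unfolding ex[unfolded Hom_complex_exact_def, rule_format, symmetric] by simp
  then have "zero_arr D (g \<cdot>\<^bsub>D\<^esub> AMap F (d (n - 1)))"
    using \<theta>_zero_iff[OF left.target.Comp_Hom[OF left.AMap_Hom[OF d'] g] X] natural_left[OF d' g X]
    by simp
  with g show "g \<in> {g \<in> Hom D (OMap F (X n)) Q. zero_arr D (g \<cdot>\<^bsub>D\<^esub> AMap F (d (n - 1)))}"
    by simp
qed

end

section \<open>Frobenius pairs\<close>

locale frobenius_adjunctions = FG: adjunction C D F G \<theta> + GF: adjunction D C G F \<theta>'
  for C :: "('o, 'm) cat" and D :: "('p, 'n) cat"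
    and F :: "('o, 'm, 'p, 'n) functr" and G :: "('p, 'n, 'o, 'm) functr"
    and \<theta> :: "'o \<Rightarrow> 'p \<Rightarrow> 'n \<Rightarrow> 'm" and \<theta>' :: "'p \<Rightarrow> 'o \<Rightarrow> 'm \<Rightarrow> 'n"
begin

text \<open>A zero object is both initial and terminal; the two halves come from the two adjunctions.\<close>

lemma F_zero:
  assumes "zero_object C Z"
  shows "zero_object D (OMap F Z)"
proof -
  from assms have Z: "Z \<in> Obj C" and terminal: "\<And>A. A \<in> Obj C \<Longrightarrow> \<exists>!f. f \<in> Hom C A Z"
    and init: "\<And>A. A \<in> Obj C \<Longrightarrow> \<exists>!f. f \<in> Hom C Z A"
    unfolding zero_object_def by simp_all
  show ?thesis
    unfolding zero_object_def
    by (intro conjI ballI FG.left.OMap_Obj[OF Z] FG.left_preserves_initial[OF Z init]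
        GF.right_preserves_terminal[OF Z terminal])
qed

lemma G_zero:
  assumes "zero_object D Z"
  shows "zero_object C (OMap G Z)"
proof -
  from assms have Z: "Z \<in> Obj D" and terminal: "\<And>A. A \<in> Obj D \<Longrightarrow> \<exists>!f. f \<in> Hom D A Z"
    and init: "\<And>A. A \<in> Obj D \<Longrightarrow> \<exists>!f. f \<in> Hom D Z A"
    unfolding zero_object_def by simp_all
  show ?thesis
    unfolding zero_object_def
    by (intro conjI ballI FG.right.OMap_Obj[OF Z] GF.left_preserves_initial[OF Z init]
        FG.right_preserves_terminal[OF Z terminal])
qed

sublocale FG: zero_preserving_adjunction C D F G \<theta>
  by (intro zero_preserving_adjunction.intro zero_preserving_adjunction_axioms.intro
      FG.adjunction_axioms F_zero G_zero)

sublocale GF: zero_preserving_adjunction D C G F \<theta>'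
  by (intro zero_preserving_adjunction.intro zero_preserving_adjunction_axioms.intro
      GF.adjunction_axioms F_zero G_zero)

text \<open>Both clauses of exactness, kernel and image, are preserved: an image is a kernel of a cokernel, and
  \<open>F\<close> preserves cokernels as a left adjoint of \<open>G\<close> and kernels as a right adjoint of \<open>G\<close>.\<close>

lemma F_preserves_exact_complex:
  assumes "exact_complex C X d"
  shows "exact_complex D (\<lambda>n. OMap F (X n)) (\<lambda>n. AMap F (d n))"
proof -
  from assms have X: "\<And>n. X n \<in> Obj C" and d: "\<And>n. d n \<in> Hom C (X n) (X (n + 1))"
    and z: "\<And>n. zero_arr C (d (n + 1) \<cdot>\<^bsub>C\<^esub> d n)" and ex: "\<And>n. exact_at C (d n) (d (n + 1))"
    unfolding exact_complex_def complex_in_def by auto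
  have "exact_at D (AMap F (d n)) (AMap F (d (n + 1)))" for n
    using ex[of n] FG.left_preserves_cokernel GF.right_preserves_kernel
    unfolding exact_at_def is_image_def by meson
  moreover have "zero_arr D (AMap F (d (n + 1)) \<cdot>\<^bsub>D\<^esub> AMap F (d n))" for n
    using FG.left.preserves_zero_arr[OF F_zero z[of n]] FG.left.AMap_Comp[OF d[of n] d[of "n + 1"]]
    by simp
  ultimately show ?thesis
    unfolding exact_complex_def complex_in_def
    using FG.left.OMap_Obj[OF X] FG.left.AMap_Hom[OF d] by blast
qed

text \<open>The image under \<open>F\<close> of a totally acyclic complex of projectives is totally acyclic. Acyclicity of
  \<open>Hom (F X, Q)\<close> uses that \<open>G\<close>, being a left adjoint of the epimorphism-preserving functor \<open>F\<close>, sends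
  the test object \<open>Q\<close> to a projective object.\<close>

lemma F_preserves_Gorenstein_projective:
  assumes "Gorenstein_projective C M"
  shows "Gorenstein_projective D (OMap F M)"
proof -
  from assms obtain X d k where M: "M \<in> Obj C" and ex: "exact_complex C X d"
    and proj: "\<And>n. projective_object C (X n)"
    and k: "is_kernel C k (d 0)" and iso: "isomorphic C M (Dom C k)"
    and hom: "\<And>Q. projective_object C Q \<Longrightarrow> Hom_complex_exact C X d Q"
    unfolding Gorenstein_projective_def by blast
  from ex have X: "\<And>n. X n \<in> Obj C" and d: "\<And>n. d n \<in> Hom C (X n) (X (n + 1))"
    unfolding exact_complex_def complex_in_def by auto
  let ?X = "\<lambda>n. OMap F (X n)" and ?d = "\<lambda>n. AMap F (d n)"
  have "projective_object D (?X n)" for n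
    by (rule FG.left_preserves_projective[OF GF.left_preserves_epi proj])
  moreover have "is_kernel D (AMap F k) (?d 0)"
    by (rule GF.right_preserves_kernel[OF k])
  moreover have "isomorphic D (OMap F M) (Dom D (AMap F k))"
  proof -
    from k have "k \<in> Hom C (Dom C k) (Cod C k)" unfolding is_kernel_def by (blast intro: Arr_Hom)
    from Hom_Dom[OF FG.left.AMap_Hom[OF this]] FG.left.preserves_isomorphic[OF iso]
    show ?thesis by simp
  qed
  moreover have "Hom_complex_exact D ?X ?d Q" if Q: "projective_object D Q" for Q
  proof (rule FG.left_Hom_complex_exact[where X = X and d = d, OF X d])
    show "Q \<in> Obj D" using Q by (simp add: projective_object_def)
    show "Hom_complex_exact C X d (OMap G Q)"
      by (rule hom, rule GF.left_preserves_projective[OF FG.left_preserves_epi Q])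
  qed
  ultimately show ?thesis
    unfolding Gorenstein_projective_def
    using FG.left.OMap_Obj[OF M] F_preserves_exact_complex[OF ex] by blast
qed

end

lemma Frobenius_pair_adjunctions:
  assumes "Frobenius_pair C D F G"
  obtains \<theta> \<theta>' where "frobenius_adjunctions C D F G \<theta> \<theta>'"
  using assms unfolding Frobenius_pair_def
  by (metis adjoint_pair_adjunction frobenius_adjunctions.intro)

lemma Frobenius_pair_sym: "Frobenius_pair C D F G \<Longrightarrow> Frobenius_pair D C G F"
  by (simp add: Frobenius_pair_def)

lemma Frobenius_preserves_GP:
  assumes "Frobenius_pair C D F G" and "M \<in> GP C"
  shows "OMap F M \<in> GP D"
proof -
  from assms(1) obtain \<theta> \<theta>' where "frobenius_adjunctions C D F G \<theta> \<theta>'"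
    by (rule Frobenius_pair_adjunctions)
  from frobenius_adjunctions.F_preserves_Gorenstein_projective[OF this] assms(2)
  show ?thesis by (simp add: GP_def)
qed

lemma separable_Frobenius_precovering_GP:
  assumes fro: "Frobenius_pair C D F G" and sep: "separable_functor C D F"
    and pre: "precovering D (GP D)"
  shows "precovering C (GP C)"
proof -
  from fro have "adjoint_pair C D F G" by (simp add: Frobenius_pair_def)
  then obtain \<theta> where "adjunction C D F G \<theta>" by (rule adjoint_pair_adjunction)
  then show ?thesis
    by (rule adjunction.separable_precovering[OF _ sep pre Frobenius_preserves_GP[OF fro]
          Frobenius_preserves_GP[OF Frobenius_pair_sym[OF fro]]])
qed

theorem theorem1p1:
  fixes C :: "('o, 'm) cat" and D :: "('p, 'n) cat"
    and F :: "('o, 'm, 'p, 'n) functr" and G :: "('p, 'n, 'o, 'm) functr"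
  assumes "abelian_category C" and "enough_projectives C"
    and "abelian_category D" and "enough_projectives D"
    and "covariant_functor C D F" and "covariant_functor D C G"
    and "Frobenius_pair C D F G"
  shows "(separable_functor D C G \<longrightarrow> precovering C (GP C) \<longrightarrow> precovering D (GP D)) \<and>
         (separable_functor C D F \<longrightarrow> precovering D (GP D) \<longrightarrow> precovering C (GP C))"
  using separable_Frobenius_precovering_GP[OF assms(7)]
    separable_Frobenius_precovering_GP[OF Frobenius_pair_sym[OF assms(7)]] by blast

end
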